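(* Let $\mathcal C$ be a cube with center $O$, and let $f\colon\mathcal C\to\mathbb{R}$ be convex on every pyramid having a face of $\mathcal C$ as base and $O$ as apex. Fix two opposite vertices $V,W$ of $\mathcal C$. Let $S$ be the union of the six edges of $\mathcal C$ meeting at $V$ or $W$, and let $Q$ be the union of the three main (space) diagonals of $\mathcal C$ joining the remaining six vertices. Then $$\operatorname{Avg}(f,\mathcal C)\le\frac12\operatorname{Avg}(f,S)+\frac12\operatorname{Avg}(f,Q).$$
   Context: $\operatorname{Avg}(f,\mathcal C)$ is the average over the cube with respect to volume; $\operatorname{Avg}(f,S)$ and $\operatorname{Avg}(f,Q)$ are averages over these unions of segments with respect to length. *)

theory Defs
  imports "HOL-Analysis.Analysis"
begin

text \<open>A general cube in R^3: image of the standard cube [-1,1]^3 under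
  x \<mapsto> c + r T x with r > 0 and T an orthogonal transformation.
  Its center is c; its vertices are the images of the sign vectors.\<close>

definition cube_map :: "real^3 \<Rightarrow> real \<Rightarrow> (real^3 \<Rightarrow> real^3) \<Rightarrow> real^3 \<Rightarrow> real^3" where
  "cube_map c r T x = c + scaleR r (T x)"

definition std_cube :: "(real^3) set" where
  "std_cube = {x. \<forall>i. \<bar>x $ i\<bar> \<le> 1}"

definition signs :: "(real^3) set" where
  "signs = {s. \<forall>i. s $ i = 1 \<or> s $ i = -1}"

definition cube :: "real^3 \<Rightarrow> real \<Rightarrow> (real^3 \<Rightarrow> real^3) \<Rightarrow> (real^3) set" where
  "cube c r T = cube_map c r T ` std_cube"

definition pyramid :: "real^3 \<Rightarrow> real \<Rightarrow> (real^3 \<Rightarrow> real^3) \<Rightarrow> 3 \<Rightarrow> real \<Rightarrow> (real^3) set" where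
  "pyramid c r T i e = convex hull (insert c (cube_map c r T ` {s \<in> signs. s $ i = e}))"

text \<open>Flip the i-th sign: the neighbouring vertex along the edge in direction i.\<close>
definition flip :: "3 \<Rightarrow> real^3 \<Rightarrow> real^3" where
  "flip i s = (\<chi> j. if j = i then - (s $ j) else s $ j)"

definition seg_integral :: "(real^3 \<Rightarrow> real) \<Rightarrow> real^3 \<Rightarrow> real^3 \<Rightarrow> real" where
  "seg_integral f a b = dist a b * integral {0..1} (\<lambda>t. f (a + scaleR t (b - a)))"

text \<open>Average of f w.r.t. length over a union of finitely many segments
  (given as pairs of endpoints) which pairwise meet in at most one point.\<close>
definition segs_avg :: "(real^3 \<Rightarrow> real) \<Rightarrow> ((real^3) \<times> (real^3)) set \<Rightarrow> real" where
  "segs_avg f P = (\<Sum>(a,b)\<in>P. seg_integral f a b) / (\<Sum>(a,b)\<in>P. dist a b)"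

definition vol_avg :: "(real^3 \<Rightarrow> real) \<Rightarrow> (real^3) set \<Rightarrow> real" where
  "vol_avg f A = integral A f / measure lebesgue A"

end

theory Submission
  imports Defs
begin

text \<open>
  Split each face of the cube along its diagonal through \<open>V\<close> or \<open>W\<close> and cone from the centre \<open>O\<close>:
  this cuts the cube into twelve congruent tetrahedra \<open>OVAD\<close>, where \<open>VA\<close> is an edge of \<open>S\<close> and \<open>OD\<close>
  is half of a diagonal of \<open>Q\<close>. On a tetrahedron with opposite edges \<open>VA\<close> and \<open>OD\<close>, a uniformly
  distributed point is \<open>(1 - s) p + s q\<close> with \<open>p\<close>, \<open>q\<close> uniform on the two edges and \<open>s\<close> independent
  with density \<open>6 s (1 - s)\<close>, so convexity bounds the mean of \<open>f\<close> by the average of its means over the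
  two edges. Each of the six edges of \<open>S\<close> and each of the six half-diagonals of \<open>Q\<close> occurs in
  exactly two tetrahedra.
\<close>

section \<open>Integration preliminaries\<close>

text \<open>The change of variables for vector-valued functions is applied to
  \<open>vec (f x)\<close> in \<open>real^1\<close>; integrability and the value are then read off
  from the single component.\<close>

lemma absolute_integral_change_of_variables_scalar:
  fixes f :: "real^'m::{finite,wellorder} \<Rightarrow> real" and g :: "real^'m::_ \<Rightarrow> real^'m::_"
  assumes S: "S \<in> sets lebesgue"
    and der: "\<And>x. x \<in> S \<Longrightarrow> (g has_derivative g' x) (at x within S)"
    and inj: "inj_on g S"
    and int: "(\<lambda>x. \<bar>det (matrix (g' x))\<bar> * f (g x)) absolutely_integrable_on S"
  shows "f absolutely_integrable_on (g ` S)"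
    and "integral (g ` S) f = integral S (\<lambda>x. \<bar>det (matrix (g' x))\<bar> * f (g x))"
proof -
  let ?v = "vec :: real \<Rightarrow> real^1"
  let ?D = "\<lambda>x. \<bar>det (matrix (g' x))\<bar> *\<^sub>R ?v (f (g x))"
  have D: "?D absolutely_integrable_on S"
    unfolding absolutely_integrable_componentwise_iff[where f="?D"]
    using int by (auto simp: Basis_vec_def inner_axis)
  have *: "(\<lambda>x. ?v (f x)) absolutely_integrable_on (g ` S)"
          "integral (g ` S) (\<lambda>x. ?v (f x)) = integral S ?D"
    using has_absolute_integral_change_of_variables[OF S der inj, of "\<lambda>x. ?v (f x)" "integral S ?D"] D
    by blast+
  show "f absolutely_integrable_on (g ` S)"
    using *(1) unfolding absolutely_integrable_componentwise_iff[where f="\<lambda>x. ?v (f x)"]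
    by (auto simp: Basis_vec_def inner_axis)
  have i1: "(\<lambda>x. ?v (f x)) integrable_on (g ` S)" and i2: "?D integrable_on S"
    using *(1) D set_lebesgue_integral_eq_integral(1) by blast+
  have "integral (g ` S) f = integral (g ` S) (\<lambda>x. ?v (f x)) $ 1"
    using integral_component_eq_cart[OF i1, of 1] by simp
  also have "\<dots> = integral S (\<lambda>x. \<bar>det (matrix (g' x))\<bar> * f (g x))"
    using integral_component_eq_cart[OF i2, of 1] *(2) by simp
  finally show "integral (g ` S) f = integral S (\<lambda>x. \<bar>det (matrix (g' x))\<bar> * f (g x))" .
qed

text \<open>Fubini for separated variables. \<open>lborel\<close> is the image of the product
  measure indexed by \<open>Basis\<close>, so the factors are reindexed from coordinates
  \<open>i\<close> to basis vectors \<open>axis i 1\<close>; this is the purpose of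
  \<open>H\<close>.\<close>

lemma lborel_integral_prod_cart:
  fixes h :: "'n::finite \<Rightarrow> real \<Rightarrow> real"
  assumes int: "\<And>i. integrable lborel (h i)"
  shows "integrable lborel (\<lambda>x::real^'n. \<Prod>i\<in>UNIV. h i (x $ i))"
    and "integral\<^sup>L lborel (\<lambda>x::real^'n. \<Prod>i\<in>UNIV. h i (x $ i)) = (\<Prod>i\<in>UNIV. integral\<^sup>L lborel (h i))"
proof -
  interpret product_sigma_finite "\<lambda>_::real^'n. lborel :: real measure" ..
  define H where "H b = h (THE i. b = axis i 1)" for b :: "real^'n"
  have H: "H (axis i 1) = h i" for i
    by (simp add: H_def axis_eq_axis)
  have B: "(Basis :: (real^'n) set) = (\<lambda>i. axis i 1) ` UNIV"
    by (auto simp: Basis_vec_def)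
  have injB: "inj (\<lambda>i. axis i 1 :: real^'n)"
    by (simp add: inj_def axis_eq_axis)
  have [measurable]: "h i \<in> borel_measurable borel" for i
    using borel_measurable_integrable[OF int, of i] by simp
  have p: "(\<Prod>i\<in>UNIV. h i (x $ i)) = (\<Prod>b\<in>Basis. H b (x \<bullet> b))" for x :: "real^'n"
    unfolding B by (subst prod.reindex[OF injB]) (simp add: H inner_axis)
  have intH: "integrable lborel (H b)" if "b \<in> Basis" for b
    using that int by (auto simp: B H)
  have q: "(\<Prod>i\<in>UNIV. h i ((\<Sum>b\<in>Basis. y b *\<^sub>R b) $ i)) = (\<Prod>b\<in>Basis. H b (y b))" for y :: "real^'n \<Rightarrow> real"
    unfolding p by (intro prod.cong) (auto simp: inner_sum_left inner_Basis if_distrib cong: if_cong)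
  have m: "(\<lambda>x::real^'n. \<Prod>i\<in>UNIV. h i (x $ i)) \<in> borel_measurable borel"
    by measurable
  have m': "(\<lambda>y. \<Sum>b\<in>Basis. y b *\<^sub>R b) \<in> measurable (Pi\<^sub>M Basis (\<lambda>b::real^'n. lborel)) borel"
    by measurable
  have "integrable (Pi\<^sub>M Basis (\<lambda>b::real^'n. lborel)) (\<lambda>y. \<Prod>b\<in>Basis. H b (y b))"
    by (rule product_integrable_prod) (auto simp: intH)
  then show "integrable lborel (\<lambda>x::real^'n. \<Prod>i\<in>UNIV. h i (x $ i))"
    by (subst lborel_eq) (simp only: integrable_distr_eq[OF m' m] q)
  have "integral\<^sup>L lborel (\<lambda>x::real^'n. \<Prod>i\<in>UNIV. h i (x $ i)) = (\<Prod>b\<in>Basis. integral\<^sup>L lborel (H b))"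
    by (subst lborel_eq, simp only: integral_distr[OF m' m] q, rule product_integral_prod)
      (auto simp: intH)
  also have "\<dots> = (\<Prod>i\<in>UNIV. integral\<^sup>L lborel (h i))"
    unfolding B by (subst prod.reindex[OF injB]) (simp add: H)
  finally show "integral\<^sup>L lborel (\<lambda>x::real^'n. \<Prod>i\<in>UNIV. h i (x $ i)) = (\<Prod>i\<in>UNIV. integral\<^sup>L lborel (h i))" .
qed

section \<open>Convex functions of one variable and their weighted integrals over the unit
  cube\<close>

lemma convex_on_affine_compose:
  fixes f :: "'b::real_vector \<Rightarrow> real" and L :: "'a::real_vector \<Rightarrow> 'b"
  assumes f: "convex_on S f" and A: "convex A" "linear L" "(\<lambda>x. c + L x) ` A \<subseteq> S"
  shows "convex_on A (\<lambda>x. f (c + L x))"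
proof (unfold convex_on_def, intro conjI ballI allI impI)
  fix x y and u v :: real assume h: "x \<in> A" "y \<in> A" "0 \<le> u" "0 \<le> v" "u + v = 1"
  have "c + L (u *\<^sub>R x + v *\<^sub>R y) = u *\<^sub>R (c + L x) + v *\<^sub>R (c + L y)"
    using h(5) A(2) by (simp add: linear_add linear_scale scaleR_add_right)
      (simp add: algebra_simps flip: scaleR_add_left)
  moreover have "c + L x \<in> S" "c + L y \<in> S" using A(3) h by auto
  ultimately show "f (c + L (u *\<^sub>R x + v *\<^sub>R y)) \<le> u * f (c + L x) + v * f (c + L y)"
    using f h unfolding convex_on_def by auto
qed (fact A(1))

text \<open>The chord between the endpoints bounds \<open>h\<close> from above. From below, 1/2 is
  the midpoint of \<open>x\<close> and \<open>1 - x\<close>, so a very negative \<open>h x\<close>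
  would force \<open>h (1 - x)\<close> above that bound.\<close>

lemma convex_on_unit_interval_bounded:
  fixes h :: "real \<Rightarrow> real"
  assumes "convex_on {0..1} h"
  shows "\<exists>B. \<forall>x\<in>{0..1}. \<bar>h x\<bar> \<le> B"
proof -
  define M where "M = max (h 0) (h 1)"
  have up: "h x \<le> M" if "x \<in> {0..1}" for x
  proof -
    have "h ((1-x) *\<^sub>R 0 + x *\<^sub>R 1) \<le> (1-x) * h 0 + x * h 1"
      using convex_onD[OF assms, of x 0 1] that by simp
    also have "\<dots> \<le> (1-x) * M + x * M"
      using that by (intro add_mono mult_left_mono) (auto simp: M_def)
    finally show ?thesis by (simp add: algebra_simps)
  qed
  have lo: "2 * h (1/2) - M \<le> h x" if "x \<in> {0..1}" for x
  proof -
    have "h ((1-1/2) *\<^sub>R x + (1/2) *\<^sub>R (1-x)) \<le> (1-1/2) * h x + (1/2) * h (1-x)"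
      using convex_onD[OF assms, of "1/2" x "1-x"] that by simp
    then show ?thesis using up[of "1-x"] that by (simp add: field_simps)
  qed
  show ?thesis
    using up lo by (intro exI[of _ "\<bar>M\<bar> + \<bar>2 * h (1/2) - M\<bar>"]) (force simp: abs_if)
qed

text \<open>A convex function may jump at the endpoints but is continuous between them.
  Measurability is therefore obtained on the open interval, and the two endpoints do not affect the
  integral.\<close>

lemma convex_on_unit_interval_integrable:
  fixes h :: "real \<Rightarrow> real"
  assumes "convex_on {0..1} h"
  shows "set_integrable lborel {0<..<1} h" "h integrable_on {0..1}"
    "(LINT x:{0<..<1}|lborel. h x) = integral {0..1} h"
proof -
  obtain B where B: "\<forall>x\<in>{0..1}. \<bar>h x\<bar> \<le> B"
    using convex_on_unit_interval_bounded[OF assms] by blast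
  have "continuous_on {0<..<1} h"
    by (intro convex_on_continuous convex_on_subset[OF assms]) auto
  then have m: "set_borel_measurable borel {0<..<1} h"
    unfolding set_borel_measurable_def
    by (intro borel_measurable_continuous_on_indicator) auto
  show i: "set_integrable lborel {0<..<1} h"
    unfolding set_integrable_def
  proof (rule Bochner_Integration.integrable_bound)
    show "integrable lborel (\<lambda>x. indicator {0<..<1::real} x *\<^sub>R B)"
      by (simp add: finite_measure_def)
    show "(\<lambda>x. indicat_real {0<..<1} x *\<^sub>R h x) \<in> borel_measurable lborel"
      using m by (simp add: set_borel_measurable_def)
    show "AE x in lborel. norm (indicat_real {0<..<1} x *\<^sub>R h x) \<le> norm (indicat_real {0<..<1} x *\<^sub>R B)"
      using B by (auto simp: indicator_def intro!: AE_I2 order_trans[OF _ abs_ge_self])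
  qed
  have hi: "(h has_integral (LINT x:{0<..<1}|lborel. h x)) {0<..<1}"
    using set_borel_integral_eq_integral[OF i] by (simp add: has_integral_integral)
  then have hi': "(h has_integral (LINT x:{0<..<1}|lborel. h x)) {0..1}"
    using has_integral_Icc_iff_Ioo by blast
  then show "h integrable_on {0..1}" "(LINT x:{0<..<1}|lborel. h x) = integral {0..1} h"
    by (auto simp: integral_unique)
qed

lemma unit_cube_integral_product:
  fixes \<phi> p q :: "real \<Rightarrow> real"
  assumes \<phi>: "continuous_on {0..1} \<phi>" and p: "convex_on {0..1} p" and q: "convex_on {0..1} q"
  shows "((\<lambda>y::real^3. \<phi> (y$1) * p (y$2)) has_integral integral {0..1} \<phi> * integral {0..1} p) (box 0 1)"
    and "((\<lambda>y::real^3. \<phi> (y$1) * q (y$3)) has_integral integral {0..1} \<phi> * integral {0..1} q) (box 0 1)"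
proof -
  let ?I = "indicat_real {0<..<1}"
  have "set_integrable lborel {0<..<1} \<phi>"
    by (rule set_integrable_subset[OF borel_integrable_compact[OF compact_Icc \<phi>, folded set_integrable_def]]) auto
  then have \<phi>1: "integrable lborel (\<lambda>x. ?I x * \<phi> x)" "integral\<^sup>L lborel (\<lambda>x. ?I x * \<phi> x) = integral {0..1} \<phi>"
    using set_borel_integral_eq_integral[of "{0<..<1}" \<phi>] integral_open_interval_real[of 0 1 \<phi>]
    by (auto simp: set_integrable_def set_lebesgue_integral_def)
  have c1: "integrable lborel (\<lambda>x. ?I x * h x)" "integral\<^sup>L lborel (\<lambda>x. ?I x * h x) = integral {0..1} h"
    if "convex_on {0..1} h" for h :: "real \<Rightarrow> real"
    using convex_on_unit_interval_integrable[OF that]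
    by (auto simp: set_integrable_def set_lebesgue_integral_def)
  have one: "convex_on {0..1} (\<lambda>_::real. 1::real)"
    by (auto simp: convex_on_def)
  have box: "indicat_real (box 0 1) y = ?I (y$1) * ?I (y$2) * ?I (y$3)" for y :: "real^3"
    by (auto simp: mem_box_cart forall_3 indicator_def)
  have prod3: "(\<Prod>i\<in>UNIV. k i) = k 1 * k 2 * k 3" for k :: "3 \<Rightarrow> real"
    unfolding UNIV_3 by simp
  have main: "((\<lambda>y::real^3. \<phi> (y$1) * (a (y$2) * b (y$3))) has_integral
      integral {0..1} \<phi> * (integral {0..1} a * integral {0..1} b)) (box 0 1)"
    if a: "convex_on {0..1} a" and b: "convex_on {0..1} b" for a b
  proof -
    define h where "h i x = ?I x * (if i = 1 then \<phi> x else if i = 2 then a x else b x)" for i :: 3 and x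
    have h: "h 1 = (\<lambda>x. ?I x * \<phi> x)" "h 2 = (\<lambda>x. ?I x * a x)" "h 3 = (\<lambda>x. ?I x * b x)"
      by (auto simp: h_def fun_eq_iff)
    have int: "integrable lborel (h i)" for i
      using exhaust_3[of i] \<phi>1(1) c1(1)[OF a] c1(1)[OF b] by (auto simp: h)
    have prod: "(\<Prod>i\<in>UNIV. h i (y$i)) = indicat_real (box 0 1) y *\<^sub>R (\<phi> (y$1) * (a (y$2) * b (y$3)))" for y :: "real^3"
      by (simp only: prod3 h box real_scaleR_def mult_ac)
    have "set_integrable lborel (box 0 (1::real^3)) (\<lambda>y. \<phi> (y$1) * (a (y$2) * b (y$3)))"
      using lborel_integral_prod_cart(1)[of h, OF int] unfolding prod set_integrable_def .
    note set_borel_integral_eq_integral[OF this]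
    moreover have "(LINT y:box 0 (1::real^3)|lborel. \<phi> (y$1) * (a (y$2) * b (y$3)))
        = integral {0..1} \<phi> * (integral {0..1} a * integral {0..1} b)"
      using lborel_integral_prod_cart(2)[of h, OF int] \<phi>1(2) c1(2)[OF a] c1(2)[OF b]
      unfolding prod set_lebesgue_integral_def by (simp add: prod3 h)
    ultimately show ?thesis by (simp add: has_integral_integral)
  qed
  show "((\<lambda>y::real^3. \<phi> (y$1) * p (y$2)) has_integral integral {0..1} \<phi> * integral {0..1} p) (box 0 1)"
    using main[OF p one] by simp
  show "((\<lambda>y::real^3. \<phi> (y$1) * q (y$3)) has_integral integral {0..1} \<phi> * integral {0..1} q) (box 0 1)"
    using main[OF one q] by simp
qed

text \<open>The beta value B(2, 3): the Jacobian \<open>s * (1 - s)\<close> of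
  \<open>edge_join\<close> times the weight \<open>1 - s\<close> of the first edge. Its agreement
  with B(3, 2) below is what gives the two opposite edges equal shares.\<close>

lemma integral_beta_2_3: "integral {0..1} (\<lambda>s::real. s * (1 - s) * (1 - s)) = 1/12"
proof (rule integral_unique)
  have "((\<lambda>s. s^2/2 - 2 * s^3/3 + s^4/4) has_real_derivative s * (1 - s) * (1 - s)) (at s within {0..1})"
    for s :: real
  proof -
    have "s * (1 - s) * (1 - s) = s - 2 * s^2 + s^3"
      by (simp add: power2_eq_square power3_eq_cube algebra_simps)
    then show ?thesis by (auto intro!: derivative_eq_intros)
  qed
  then have "((\<lambda>s::real. s * (1 - s) * (1 - s)) has_integral
      (1^2/2 - 2 * 1^3/3 + 1^4/4) - (0^2/2 - 2 * 0^3/3 + 0^4/4)) {0..1}"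
    by (intro fundamental_theorem_of_calculus)
      (auto simp flip: has_real_derivative_iff_has_vector_derivative)
  then show "((\<lambda>s::real. s * (1 - s) * (1 - s)) has_integral 1/12) {0..1}" by simp
qed

lemma integral_beta_3_2: "integral {0..1} (\<lambda>s::real. s * (1 - s) * s) = 1/12"
proof (rule integral_unique)
  have "((\<lambda>s. s^3/3 - s^4/4) has_real_derivative s * (1 - s) * s) (at s within {0..1})" for s :: real
  proof -
    have "s * (1 - s) * s = s^2 - s^3"
      by (simp add: power2_eq_square power3_eq_cube algebra_simps)
    then show ?thesis by (auto intro!: derivative_eq_intros)
  qed
  then have "((\<lambda>s::real. s * (1 - s) * s) has_integral (1^3/3 - 1^4/4) - (0^3/3 - 0^4/4)) {0..1}"
    by (intro fundamental_theorem_of_calculus)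
      (auto simp flip: has_real_derivative_iff_has_vector_derivative)
  then show "((\<lambda>s::real. s * (1 - s) * s) has_integral 1/12) {0..1}" by simp
qed

section \<open>Convex functions on a tetrahedron\<close>

definition open_tetra :: "(real^3) set" where
  "open_tetra = {x. (\<forall>i. 0 < x $ i) \<and> x$1 + x$2 + x$3 < 1}"

text \<open>Convexity is required here because the two opposite edges lie on the boundary;
  integration takes place over \<open>open_tetra\<close>, where a convex function is
  continuous.\<close>

definition closed_tetra :: "(real^3) set" where
  "closed_tetra = {x. (\<forall>i. 0 \<le> x $ i) \<and> x$1 + x$2 + x$3 \<le> 1}"

text \<open>A point of \<open>open_tetra\<close> is the point dividing a segment between the opposite edges
  \<open>{(1 - u, u, 0)}\<close> and \<open>{(0, 0, w)}\<close> in the ratio \<open>s : 1 - s\<close>; the coordinates of \<open>y\<close> are \<open>s, u, w\<close>.\<close>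
definition edge_join :: "real^3 \<Rightarrow> real^3" where
  "edge_join y = vector [(1 - y$1) * (1 - y$2), (1 - y$1) * y$2, y$1 * y$3]"

definition edge_join_deriv :: "real^3 \<Rightarrow> real^3 \<Rightarrow> real^3" where
  "edge_join_deriv y h = vector [- h$1 * (1 - y$2) - (1 - y$1) * h$2,
     - h$1 * y$2 + (1 - y$1) * h$2, h$1 * y$3 + y$1 * h$3]"

lemma edge_join_has_derivative:
  "(edge_join has_derivative edge_join_deriv y) (at y within S)"
proof -
  have nth: "((\<lambda>x::real^3. x $ i) has_derivative (\<lambda>x. x $ i)) (at y within S)" for i
    by (rule bounded_linear_imp_has_derivative) (rule bounded_linear_vec_nth)
  have "((\<lambda>x. edge_join x $ i) has_derivative (\<lambda>x. edge_join_deriv y x $ i)) (at y within S)" for i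
    using exhaust_3[of i]
    by (auto simp: edge_join_def edge_join_deriv_def algebra_simps
        intro!: derivative_eq_intros nth)
  then show ?thesis
    by (subst has_derivative_componentwise_within) (auto simp: Basis_vec_def inner_axis)
qed

text \<open>In absolute value this is the density \<open>6 * s * (1 - s)\<close> of the ratio
  \<open>s\<close> multiplied by the volume 1/6 of the tetrahedron.\<close>

lemma det_edge_join_deriv: "det (matrix (edge_join_deriv y)) = - (y$1 * (1 - y$1))"
  by (simp add: det_3 matrix_def edge_join_deriv_def axis_def) (simp add: algebra_simps)

lemma inj_on_edge_join: "inj_on edge_join (box 0 1)"
proof (rule inj_onI)
  fix x y assume h: "x \<in> box 0 (1::real^3)" "y \<in> box 0 (1::real^3)" "edge_join x = edge_join y"
  have c: "(1 - x$1) * (1 - x$2) = (1 - y$1) * (1 - y$2)" "(1 - x$1) * x$2 = (1 - y$1) * y$2"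
    "x$1 * x$3 = y$1 * y$3"
    using arg_cong[OF h(3), of "\<lambda>v. v$1"] arg_cong[OF h(3), of "\<lambda>v. v$2"] arg_cong[OF h(3), of "\<lambda>v. v$3"]
    by (simp_all add: edge_join_def)
  \<comment> \<open>Adding the first two equations eliminates the second coordinates and leaves
    \<open>1 - x$1 = 1 - y$1\<close>.\<close>
  then have "x$1 = y$1" by (simp add: algebra_simps)
  with c h(1,2) show "x = y"
    by (auto simp: vec_eq_iff forall_3 mem_box_cart)
qed

lemma edge_join_image: "edge_join ` box 0 1 = open_tetra"
proof
  show "edge_join ` box 0 1 \<subseteq> open_tetra"
  proof (clarsimp simp: open_tetra_def edge_join_def mem_box_cart forall_3)
    fix y :: "real^3" assume "y$3 < 1" "0 < y$1"
    then have "y$1 * y$3 < y$1" by simp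
    then show "(1 - y$1) * (1 - y$2) + (1 - y$1) * y$2 + y$1 * y$3 < 1"
      by (simp add: algebra_simps)
  qed
  show "open_tetra \<subseteq> edge_join ` box 0 1"
  proof
    fix x assume x: "x \<in> open_tetra"
    \<comment> \<open>The first two coordinates of an image point add up to \<open>1 - s\<close>;
      this determines \<open>s\<close>, and then \<open>u\<close> and \<open>w\<close> are
      quotients.\<close>
    let ?y = "vector [1 - (x$1 + x$2), x$2 / (x$1 + x$2), x$3 / (1 - (x$1 + x$2))] :: real^3"
    have pos: "0 < x$1" "0 < x$2" "0 < x$3" "x$1 + x$2 + x$3 < 1"
      using x by (auto simp: open_tetra_def)
    have "?y \<in> box 0 1" using pos by (auto simp: mem_box_cart forall_3 divide_simps)
    moreover have "edge_join ?y = x"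
      using pos by (auto simp: vec_eq_iff forall_3 edge_join_def field_simps)
    ultimately show "x \<in> edge_join ` box 0 1" by (metis image_eqI)
  qed
qed

lemma convex_closed_tetra: "convex closed_tetra"
proof (rule convexI)
  fix x y and u v :: real
  assume h: "x \<in> closed_tetra" "y \<in> closed_tetra" "0 \<le> u" "0 \<le> v" "u + v = 1"
  have "u * (x$1+x$2+x$3) + v * (y$1+y$2+y$3) \<le> u * 1 + v * 1"
    using h by (intro add_mono mult_left_mono) (auto simp: closed_tetra_def)
  then show "u *\<^sub>R x + v *\<^sub>R y \<in> closed_tetra"
    using h by (auto simp: closed_tetra_def algebra_simps)
qed

lemma open_open_tetra: "open open_tetra"
  unfolding edge_join_image[symmetric]
  by (intro invariance_of_domain inj_on_edge_join open_box
      has_derivative_continuous_on[OF edge_join_has_derivative])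

lemma open_tetra_subset: "open_tetra \<subseteq> closed_tetra"
  by (auto simp: open_tetra_def closed_tetra_def less_imp_le)

text \<open>Convexity along the segment between the two edge points that \<open>edge_join\<close>
  connects gives the pointwise bound \<open>up\<close>. Integrated against the Jacobian, it gives
  each edge the weight 1/12, half the volume 1/6 of the tetrahedron.\<close>

lemma tetra_opposite_edges:
  assumes g: "convex_on closed_tetra g"
  shows "g absolutely_integrable_on open_tetra"
    and "integral open_tetra g \<le>
      (integral {0..1} (\<lambda>t. g (vector [1 - t, t, 0])) + integral {0..1} (\<lambda>t. g (vector [0, 0, t]))) / 12"
proof -
  define p where "p t = g (vector [1 - t, t, 0])" for t
  define q where "q t = g (vector [0, 0, t])" for t
  define m :: "real^3" where "m = vector [1/4, 1/4, 1/4]"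
  have "convex_on {0..1} (\<lambda>t::real. g (vector [1, 0, 0] + t *\<^sub>R vector [-1, 1, 0]))"
    by (rule convex_on_affine_compose[OF g])
      (auto simp: closed_tetra_def forall_3 intro!: linearI simp: algebra_simps)
  moreover have "vector [1, 0, 0] + t *\<^sub>R vector [-1, 1, 0] = (vector [1 - t, t, 0] :: real^3)" for t :: real
    by (simp add: vec_eq_iff forall_3)
  ultimately have p: "convex_on {0..1} p" by (simp add: p_def[abs_def])
  have "convex_on {0..1} (\<lambda>t::real. g (0 + t *\<^sub>R vector [0, 0, 1]))"
    by (rule convex_on_affine_compose[OF g])
      (auto simp: closed_tetra_def forall_3 intro!: linearI simp: algebra_simps)
  moreover have "0 + t *\<^sub>R vector [0, 0, 1] = (vector [0, 0, t] :: real^3)" for t :: real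
    by (simp add: vec_eq_iff forall_3)
  ultimately have q: "convex_on {0..1} q" by (simp add: q_def[abs_def])
  have up: "g (edge_join y) \<le> (1 - y$1) * p (y$2) + y$1 * q (y$3)" if "y \<in> box 0 1" for y
  proof -
    have y: "0 < y$i" "y$i < 1" for i using that by (auto simp: mem_box_cart)
    have "edge_join y = (1 - y$1) *\<^sub>R vector [1 - y$2, y$2, 0] + y$1 *\<^sub>R vector [0, 0, y$3]"
      by (simp add: vec_eq_iff forall_3 edge_join_def)
    then show ?thesis
      using convex_onD[OF g, of "y$1" "vector [1 - y$2, y$2, 0]" "vector [0, 0, y$3]"] y
      by (simp add: p_def q_def closed_tetra_def forall_3 less_imp_le)
  qed
  \<comment> \<open>Integrability rests on two-sided bounds: bounds for \<open>g\<close> on the two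
    edges pass to the interior through \<open>up\<close>, and the value at the barycentre then
    bounds \<open>g\<close> from below.\<close>
  obtain B1 B2 where B1: "\<forall>x\<in>{0..1}. \<bar>p x\<bar> \<le> B1" and B2: "\<forall>x\<in>{0..1}. \<bar>q x\<bar> \<le> B2"
    using convex_on_unit_interval_bounded p q by metis
  define M where "M = max B1 B2"
  have upM: "g x \<le> M" if x: "x \<in> open_tetra" for x
  proof -
    obtain y where y: "y \<in> box 0 1" "x = edge_join y"
      using x edge_join_image by blast
    then have yi: "0 < y$i" "y$i < 1" for i by (auto simp: mem_box_cart)
    have "p (y$2) \<le> M" "q (y$3) \<le> M"
      using B1[rule_format, of "y$2"] B2[rule_format, of "y$3"] yi[of 2] yi[of 3] by (auto simp: M_def)
    then have "(1 - y$1) * p (y$2) + y$1 * q (y$3) \<le> (1 - y$1) * M + y$1 * M"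
      using yi[of 1] by (intro add_mono mult_left_mono) auto
    then show ?thesis using up[OF y(1)] y(2) by (simp add: algebra_simps)
  qed
  have lo: "4 * g m - 3 * M \<le> g x" if x: "x \<in> open_tetra" for x
  proof -
    define x' where "x' = (1/3) *\<^sub>R (1 - x)"
    \<comment> \<open>the barycentre \<open>m\<close> of the tetrahedron lies on the segment from \<open>x\<close> to \<open>x'\<close>\<close>
    have x': "x' \<in> open_tetra"
      using x by (auto simp: open_tetra_def x'_def forall_3 field_simps)
    have "m = (1 - 3/4) *\<^sub>R x + (3/4) *\<^sub>R x'"
      by (simp add: m_def x'_def vec_eq_iff forall_3 field_simps)
    then have "g m \<le> (1 - 3/4) * g x + (3/4) * g x'"
      using convex_onD[OF g, of "3/4" x x'] x x' open_tetra_subset by auto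
    then show ?thesis using upM[OF x'] by simp
  qed
  have cont: "continuous_on open_tetra g"
  proof (rule continuous_on_subset)
    show "continuous_on (interior closed_tetra) g"
      by (intro convex_on_continuous convex_on_subset[OF g] convex_interior convex_closed_tetra
          open_interior interior_subset)
    show "open_tetra \<subseteq> interior closed_tetra"
      by (rule interior_maximal[OF open_tetra_subset open_open_tetra])
  qed
  define F where "F y = \<bar>det (matrix (edge_join_deriv y))\<bar> * g (edge_join y)" for y
  have F: "F y = y$1 * (1 - y$1) * g (edge_join y)" if "y \<in> box 0 1" for y
    using that by (simp add: F_def det_edge_join_deriv mem_box_cart abs_of_nonneg less_imp_le)
  have "continuous_on (box 0 1) edge_join"
    by (rule has_derivative_continuous_on[OF edge_join_has_derivative])
  then have "continuous_on (box 0 1) (\<lambda>y. g (edge_join y))"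
    by (rule continuous_on_compose2[OF cont]) (simp add: edge_join_image)
  then have "continuous_on (box 0 1) (\<lambda>y. y$1 * (1 - y$1) * g (edge_join y))"
    by (intro continuous_intros)
  then have contF: "continuous_on (box 0 1) F"
    by (rule continuous_on_eq) (simp add: F)
  have intF: "F absolutely_integrable_on box 0 1"
  proof (rule measurable_bounded_by_integrable_imp_absolutely_integrable)
    show "F \<in> borel_measurable (lebesgue_on (box 0 1))"
      by (intro continuous_imp_measurable_on_sets_lebesgue contF) auto
    show "(\<lambda>_. \<bar>M\<bar> + \<bar>4 * g m - 3 * M\<bar>) integrable_on box 0 (1::real^3)"
      by (rule integrable_on_const) auto
    fix y :: "real^3" assume y: "y \<in> box 0 1"
    then have "edge_join y \<in> open_tetra" using edge_join_image by blast
    from upM[OF this] lo[OF this]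
    have 1: "\<bar>g (edge_join y)\<bar> \<le> \<bar>M\<bar> + \<bar>4 * g m - 3 * M\<bar>" by linarith
    have "\<bar>y$1 * (1 - y$1)\<bar> \<le> 1"
      using y mult_le_one[of "y$1" "1 - y$1"] by (simp add: mem_box_cart abs_of_nonneg less_imp_le)
    from mult_mono[OF this 1] show "norm (F y) \<le> \<bar>M\<bar> + \<bar>4 * g m - 3 * M\<bar>"
      by (simp add: F[OF y] abs_mult)
  qed auto
  note cov = absolute_integral_change_of_variables_scalar[OF _ edge_join_has_derivative
      inj_on_edge_join intF[unfolded F_def], unfolded edge_join_image, folded F_def]
  show "g absolutely_integrable_on open_tetra" by (rule cov) auto
  \<comment> \<open>The integrand is the right side of \<open>up\<close> multiplied by the
    Jacobian.\<close>
  have G: "((\<lambda>y::real^3. y$1 * (1 - y$1) * (1 - y$1) * p (y$2) + y$1 * (1 - y$1) * y$1 * q (y$3))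
      has_integral 1/12 * integral {0..1} p + 1/12 * integral {0..1} q) (box 0 1)"
    by (rule has_integral_add[OF
          unit_cube_integral_product(1)[OF _ p q, of "\<lambda>s. s * (1 - s) * (1 - s)", unfolded integral_beta_2_3]
          unit_cube_integral_product(2)[OF _ p q, of "\<lambda>s. s * (1 - s) * s", unfolded integral_beta_3_2]])
      (auto intro!: continuous_intros)
  have "integral open_tetra g = integral (box 0 1) F" by (rule cov) auto
  also have "\<dots> \<le> 1/12 * integral {0..1} p + 1/12 * integral {0..1} q"
  proof (rule has_integral_le[OF _ G])
    show "(F has_integral integral (box 0 1) F) (box 0 1)"
      using intF set_lebesgue_integral_eq_integral(1) has_integral_integral by blast
    fix y :: "real^3" assume y: "y \<in> box 0 1"
    then have "0 \<le> y$1 * (1 - y$1)" by (auto simp: mem_box_cart less_imp_le)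
    from mult_left_mono[OF up[OF y] this]
    show "F y \<le> y$1 * (1 - y$1) * (1 - y$1) * p (y$2) + y$1 * (1 - y$1) * y$1 * q (y$3)"
      by (simp add: F[OF y] algebra_simps)
  qed
  finally show "integral open_tetra g \<le>
      (integral {0..1} (\<lambda>t. g (vector [1 - t, t, 0])) + integral {0..1} (\<lambda>t. g (vector [0, 0, t]))) / 12"
    by (simp add: p_def[abs_def] q_def[abs_def])
qed

section \<open>The twelve tetrahedra of the cube\<close>

lemma flip_nth: "flip i s $ j = (if j = i then - (s $ j) else s $ j)"
  by (simp add: flip_def)

text \<open>Signs are nonzero, so a flip changes exactly one entry. This keeps the three edges at a
  vertex distinct as pairs of endpoints.\<close>

lemma flip_eq_iff: "s \<in> signs \<Longrightarrow> flip i s = flip j s \<longleftrightarrow> i = j"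
  by (auto simp: flip_def signs_def vec_eq_iff) (metis equal_neg_zero zero_neq_neg_one zero_neq_one)

text \<open>In coordinates with \<open>V = (1, 1, 1)\<close>, \<open>tetra_map e i k\<close> sends the standard tetrahedron to the one with
  vertices \<open>0\<close>, \<open>e V\<close>, its neighbour in direction \<open>k\<close>, and the vertex opposite to \<open>e V\<close> in the face \<open>x\<^sub>i = e\<close>.
  Its interior consists of the points of the open cube for which coordinate \<open>i\<close> is the largest in absolute
  value and has sign \<open>e\<close>, and \<open>e\<close> times coordinate \<open>k\<close> is the smallest.\<close>
definition tetra_map :: "real \<Rightarrow> 3 \<Rightarrow> 3 \<Rightarrow> real^3 \<Rightarrow> real^3" where
  "tetra_map e i k x = e *\<^sub>R (x$1 *\<^sub>R 1 + x$2 *\<^sub>R flip k 1 - x$3 *\<^sub>R flip i 1)"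

definition cube_tetra :: "real \<Rightarrow> 3 \<Rightarrow> 3 \<Rightarrow> (real^3) set" where
  "cube_tetra e i k = {x. e * x$i < 1 \<and> (\<forall>m. m \<noteq> i \<longrightarrow> \<bar>x$m\<bar> < e * x$i) \<and> (\<forall>m. m \<noteq> k \<longrightarrow> e * x$k < e * x$m)}"

lemma linear_tetra_map: "linear (tetra_map e i k)"
  by (rule linearI) (simp_all add: tetra_map_def algebra_simps)

text \<open>Each tetrahedron thus has volume 4/6 = 2/3, and twelve of them make up the volume 8 of
  the standard cube.\<close>

lemma det_tetra_map:
  assumes "e \<in> {1, -1}" "i \<noteq> k"
  shows "\<bar>det (matrix (tetra_map e i k))\<bar> = 4"
  using assms exhaust_3[of i] exhaust_3[of k]
  by (elim disjE insertE) (simp_all add: det_3 matrix_def tetra_map_def flip_nth axis_def)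

lemma tetra_map_image:
  assumes e: "e \<in> {1, -1}" and ik: "i \<noteq> k"
  shows "tetra_map e i k ` open_tetra = cube_tetra e i k"
proof
  show "tetra_map e i k ` open_tetra \<subseteq> cube_tetra e i k"
    using assms exhaust_3[of i] exhaust_3[of k]
    by (elim disjE insertE)
      (auto simp: open_tetra_def cube_tetra_def tetra_map_def flip_nth forall_3)
  obtain j where j: "j \<noteq> i" "j \<noteq> k"
    using ik exhaust_3[of i] exhaust_3[of k] that[of 1] that[of 2] that[of 3] by auto
  show "cube_tetra e i k \<subseteq> tetra_map e i k ` open_tetra"
  proof
    fix x assume x: "x \<in> cube_tetra e i k"
    \<comment> \<open>For a preimage with coordinates \<open>a, b, c\<close>, the numbers
      \<open>e * x$i\<close>, \<open>e * x$j\<close>, \<open>e * x$k\<close> are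
      \<open>a + b + c\<close>, \<open>a + b - c\<close>, \<open>a - b - c\<close>; this system is
      solved for \<open>a, b, c\<close>.\<close>
    let ?y = "vector [(e * x$i + e * x$k) / 2, (e * x$j - e * x$k) / 2, (e * x$i - e * x$j) / 2] :: real^3"
    have "tetra_map e i k ?y = x"
      using e ik j exhaust_3[of i] exhaust_3[of k] exhaust_3[of j]
      by (elim disjE insertE) (auto simp: vec_eq_iff forall_3 tetra_map_def flip_nth field_simps)
    moreover have "?y \<in> open_tetra"
    proof -
      have "\<bar>x$j\<bar> < e * x$i" "\<bar>x$k\<bar> < e * x$i" "e * x$k < e * x$j" "e * x$i < 1"
        using x j ik unfolding cube_tetra_def by (simp_all add: ik[symmetric])
      then show ?thesis using e
        by (auto simp: open_tetra_def forall_3 field_simps)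
    qed
    ultimately show "x \<in> tetra_map e i k ` open_tetra" by (metis image_eqI)
  qed
qed

text \<open>Each tetrahedron lies in a single pyramid, which is how the convexity hypothesis becomes
  usable: \<open>w\<close> lists the apex and three vertices of the face, \<open>u\<close> the
  barycentric coordinates.\<close>

lemma tetra_map_closed_subset:
  assumes e: "e \<in> {1, -1}" and ik: "i \<noteq> k"
  shows "tetra_map e i k ` closed_tetra \<subseteq> convex hull (insert 0 {s \<in> signs. s $ i = e})" (is "_ \<subseteq> ?C")
proof
  fix z assume "z \<in> tetra_map e i k ` closed_tetra"
  then obtain x where x: "x \<in> closed_tetra" "z = tetra_map e i k x" by blast
  define u where "u = (!) [1 - (x$1 + x$2 + x$3), x$1, x$2, x$3]"
  define w where "w = (!) [0, e *\<^sub>R (1::real^3), e *\<^sub>R flip k 1, - (e *\<^sub>R flip i 1)]"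
  have 4: "{..<4} = {0, 1, 2, 3::nat}" by auto
  have "(\<Sum>j\<in>{..<4::nat}. u j *\<^sub>R w j) \<in> ?C"
  proof (rule convex_sum[OF _ convex_convex_hull])
    show "sum u {..<4} = 1" by (simp add: 4 u_def)
    show "0 \<le> u j" if "j \<in> {..<4}" for j
      using that x(1) by (auto simp: 4 u_def closed_tetra_def)
    show "w j \<in> ?C" if "j \<in> {..<4}" for j
      using that e ik
      by (intro hull_inc) (auto simp: 4 w_def signs_def flip_nth split: if_splits)
  qed simp
  then show "z \<in> ?C"
    by (simp add: x(2) 4 u_def w_def tetra_map_def algebra_simps)
qed

text \<open>The bound for the standard tetrahedron transported by \<open>tetra_map\<close>. The
  Jacobian 4 turns 1/12 into 1/3, half the volume 2/3. The two integrals run along an edge of the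
  cube and along a half-diagonal from the centre.\<close>

lemma cube_tetra_bound:
  assumes e: "e \<in> {1, -1}" and ik: "i \<noteq> k"
    and g: "convex_on (convex hull (insert 0 {s \<in> signs. s $ i = e})) g"
  shows "g absolutely_integrable_on cube_tetra e i k"
    and "integral (cube_tetra e i k) g \<le>
      1/3 * (integral {0..1} (\<lambda>t. g (e *\<^sub>R 1 + t *\<^sub>R (flip k (e *\<^sub>R 1) - e *\<^sub>R 1)))
           + integral {0..1} (\<lambda>t. g (t *\<^sub>R (- flip i (e *\<^sub>R 1)))))"
proof -
  let ?L = "tetra_map e i k"
  have "convex_on closed_tetra (\<lambda>x. g (0 + ?L x))"
    by (rule convex_on_affine_compose[OF g convex_closed_tetra linear_tetra_map])
      (use tetra_map_closed_subset[OF e ik] in simp)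
  then have c: "convex_on closed_tetra (\<lambda>x. g (?L x))" by simp
  have inj: "inj_on ?L open_tetra"
    using det_tetra_map[OF e ik] det_nz_iff_inj[OF linear_tetra_map, of e i k]
    by (metis abs_zero inj_on_subset subset_UNIV zero_neq_numeral)
  note cov = absolute_integral_change_of_variables_scalar[OF _
      linear_imp_has_derivative[OF linear_tetra_map] inj,
      unfolded det_tetra_map[OF e ik] tetra_map_image[OF e ik], of g]
  have S: "open_tetra \<in> sets lebesgue"
    using borel_open[OF open_open_tetra] by (simp add: sets_completionI_sets)
  have ab: "(\<lambda>x. 4 * g (?L x)) absolutely_integrable_on open_tetra"
    using tetra_opposite_edges(1)[OF c] by simp
  show "g absolutely_integrable_on cube_tetra e i k" by (rule cov(1)[OF S ab])
  have L1: "?L (vector [1 - t, t, 0]) = e *\<^sub>R 1 + t *\<^sub>R (flip k (e *\<^sub>R 1) - e *\<^sub>R 1)" for t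
    by (auto simp: vec_eq_iff tetra_map_def flip_nth algebra_simps)
  have L2: "?L (vector [0, 0, t]) = t *\<^sub>R (- flip i (e *\<^sub>R 1))" for t
    by (auto simp: vec_eq_iff tetra_map_def flip_nth algebra_simps)
  have "integral (cube_tetra e i k) g = 4 * integral open_tetra (\<lambda>x. g (?L x))"
    using cov(2)[OF S ab] by simp
  also have "\<dots> \<le> 4 * ((integral {0..1} (\<lambda>t. g (e *\<^sub>R 1 + t *\<^sub>R (flip k (e *\<^sub>R 1) - e *\<^sub>R 1)))
      + integral {0..1} (\<lambda>t. g (t *\<^sub>R (- flip i (e *\<^sub>R 1))))) / 12)"
    using tetra_opposite_edges(2)[OF c] unfolding L1 L2 by (rule mult_left_mono) simp
  finally show "integral (cube_tetra e i k) g \<le>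
      1/3 * (integral {0..1} (\<lambda>t. g (e *\<^sub>R 1 + t *\<^sub>R (flip k (e *\<^sub>R 1) - e *\<^sub>R 1)))
           + integral {0..1} (\<lambda>t. g (t *\<^sub>R (- flip i (e *\<^sub>R 1)))))"
    by simp
qed

section \<open>Tiling the cube by the twelve tetrahedra, up to a null set\<close>

lemma cube_tetra_pos:
  assumes "x \<in> cube_tetra e i k" "i \<noteq> k"
  shows "0 < e * x$i"
proof -
  have "\<bar>x$k\<bar> < e * x$i" using assms(1) assms(2)[symmetric] by (simp add: cube_tetra_def)
  then show ?thesis by linarith
qed

text \<open>A point determines its tetrahedron: \<open>i\<close> is the position of the largest
  absolute value, \<open>e\<close> the sign of that coordinate, and \<open>k\<close> the position of
  the smallest \<open>e * x$m\<close>.\<close>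

lemma cube_tetra_disjoint:
  assumes e: "e \<in> {1, -1}" "e' \<in> {1, -1}"
    and x: "x \<in> cube_tetra e i k" "x \<in> cube_tetra e' i' k'" and "i \<noteq> k" "i' \<noteq> k'"
  shows "e = e' \<and> i = i' \<and> k = k'"
proof -
  have abs: "e * x$i = \<bar>x$i\<bar>" "e' * x$i' = \<bar>x$i'\<bar>"
    using e cube_tetra_pos[OF x(1)] cube_tetra_pos[OF x(2)] assms by auto
  have i: "i = i'"
    using x abs unfolding cube_tetra_def by (smt (verit) mem_Collect_eq)
  moreover have e: "e = e'"
    using cube_tetra_pos[OF x(1)] cube_tetra_pos[OF x(2)] assms i by auto
  moreover have "k = k'"
    using x e unfolding cube_tetra_def by (smt (verit) mem_Collect_eq)
  ultimately show ?thesis by blast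
qed

lemma std_cube_eq_cbox: "std_cube = cbox (-1) 1"
  by (auto simp: std_cube_def mem_box_cart abs_le_iff minus_le_iff)

lemma cube_tetra_subset:
  assumes "e \<in> {1, -1}" "i \<noteq> k"
  shows "cube_tetra e i k \<subseteq> std_cube"
proof
  fix x assume x: "x \<in> cube_tetra e i k"
  then have "\<bar>x$m\<bar> < e * x$i" if "m \<noteq> i" for m
    using that by (simp add: cube_tetra_def)
  moreover have "\<bar>x$i\<bar> < 1"
    using x assms cube_tetra_pos[OF x assms(2)] by (auto simp: cube_tetra_def)
  moreover have "e * x$i < 1" using x by (simp add: cube_tetra_def)
  ultimately have "\<bar>x$m\<bar> \<le> 1" for m
    by (cases "m = i") (auto intro: less_imp_le less_trans)
  then show "x \<in> std_cube" by (simp add: std_cube_def)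
qed

text \<open>Away from the finitely many planes on which some \<open>\<bar>x$m\<bar>\<close> is 1 or
  two absolute values agree, the largest absolute value and the smallest \<open>e * x$m\<close> are
  attained strictly and so select a tetrahedron.\<close>

lemma negligible_std_cube_diff:
  "negligible (std_cube - (\<Union>(e, i, k)\<in>{1, -1} \<times> {(i, k). i \<noteq> k}. cube_tetra e i k))"
proof (rule negligible_subset)
  define N1 where "N1 m a = {x::real^3. axis m 1 \<bullet> x = a}" for m a
  define N2 where "N2 m n a = {x::real^3. (axis m 1 - a *\<^sub>R axis n 1) \<bullet> x = 0}" for m n a
  let ?N = "(\<Union>m. \<Union>a\<in>{1, -1}. N1 m a) \<union> (\<Union>(m, n)\<in>{(m, n). m \<noteq> n}. \<Union>a\<in>{1, -1}. N2 m n a)"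
  have N1: "negligible (N1 m a)" for m a
    unfolding N1_def by (rule negligible_hyperplane) (simp add: axis_eq_0_iff)
  have N2: "negligible (N2 m n a)" if "m \<noteq> n" for m n a
  proof -
    have "(axis m 1 - a *\<^sub>R axis n 1 :: real^3) $ m \<noteq> 0" using that by (simp add: axis_def)
    then have "axis m 1 - a *\<^sub>R axis n 1 \<noteq> (0::real^3)" by (metis zero_index)
    then show ?thesis unfolding N2_def by (intro negligible_hyperplane disjI1)
  qed
  have fin: "finite {(m, n::3). m \<noteq> n}" by (rule finite_subset[OF subset_UNIV]) simp
  show "negligible ?N"
    by (intro negligible_Un negligible_Union finite_imageI fin finite_UNIV)
      (auto simp: N1 N2 intro!: negligible_Un)
  show "std_cube - (\<Union>(e, i, k)\<in>{1, -1} \<times> {(i, k). i \<noteq> k}. cube_tetra e i k) \<subseteq> ?N"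
  proof (rule subsetI, rule ccontr)
    fix x assume x: "x \<in> std_cube - (\<Union>(e, i, k)\<in>{1, -1} \<times> {(i, k). i \<noteq> k}. cube_tetra e i k)"
      and n: "x \<notin> ?N"
    have ne1: "\<bar>x$m\<bar> \<noteq> 1" for m
      using n by (auto simp: N1_def inner_axis' abs_if split: if_splits)
    have ne2: "\<bar>x$m\<bar> \<noteq> \<bar>x$n\<bar>" if "m \<noteq> n" for m n
      using n that by (auto simp: N2_def inner_diff_left inner_axis' abs_eq_iff)
    have "\<bar>x$m\<bar> < 1" for m using x ne1[of m] by (auto simp: std_cube_def order_less_le)
    moreover obtain i where i: "\<And>m. \<bar>x$m\<bar> \<le> \<bar>x$i\<bar>"
    proof -
      have "Max (range (\<lambda>m. \<bar>x$m\<bar>)) \<in> range (\<lambda>m. \<bar>x$m\<bar>)" by (rule Max_in) auto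
      then obtain i where "Max (range (\<lambda>m. \<bar>x$m\<bar>)) = \<bar>x$i\<bar>" by (rule imageE)
      then show ?thesis using that[of i] by (metis Max_ge finite finite_imageI rangeI)
    qed
    have i': "\<bar>x$m\<bar> < \<bar>x$i\<bar>" if "m \<noteq> i" for m
      using i[of m] ne2[OF that] by simp
    define e :: real where "e = (if 0 \<le> x$i then 1 else -1)"
    have e: "e \<in> {1, -1}" "e * x$i = \<bar>x$i\<bar>" by (auto simp: e_def)
    obtain k where k: "\<And>m. e * x$k \<le> e * x$m"
    proof -
      have "Min (range (\<lambda>m. e * x$m)) \<in> range (\<lambda>m. e * x$m)" by (rule Min_in) auto
      then obtain k where "Min (range (\<lambda>m. e * x$m)) = e * x$k" by (rule imageE)
      then show ?thesis using that[of k] by (metis Min_le finite finite_imageI rangeI)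
    qed
    have k': "e * x$k < e * x$m" if "m \<noteq> k" for m
      using k[of m] ne2[OF that] e(1) by auto
    \<comment> \<open>Since \<open>e * x$i\<close> equals the largest absolute value, it cannot also
      be the strict minimum.\<close>
    have "i \<noteq> k"
    proof
      assume "i = k"
      obtain m where "m \<noteq> i" using exhaust_3[of i] by (metis zero_neq_one)
      with k'[of m] i'[of m] e \<open>i = k\<close> show False by auto
    qed
    with e i' k' have "x \<in> cube_tetra e i k"
      using \<open>\<bar>x$i\<bar> < 1\<close> by (simp add: cube_tetra_def)
    with x e(1) \<open>i \<noteq> k\<close> show False by blast
  qed
qed

text \<open>Sum over the tetrahedra. An edge, given by \<open>e\<close> and \<open>k\<close>, occurs
  for two values of \<open>i\<close>, and a half-diagonal, given by \<open>e\<close> and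
  \<open>i\<close>, for two values of \<open>k\<close>; hence 2 * 1/3. The half-diagonal of
  \<open>(e, i)\<close> is indexed by \<open>- e\<close>, which the sum over both signs
  absorbs.\<close>

lemma std_cube_bound:
  assumes g: "\<And>i e. e \<in> {1, -1} \<Longrightarrow> convex_on (convex hull (insert 0 {s \<in> signs. s $ i = e})) g"
  shows "g absolutely_integrable_on std_cube"
    and "integral std_cube g \<le> 2/3 * (\<Sum>(e, i)\<in>{1, -1} \<times> UNIV.
       integral {0..1} (\<lambda>t. g (e *\<^sub>R 1 + t *\<^sub>R (flip i (e *\<^sub>R 1) - e *\<^sub>R 1)))
     + integral {0..1} (\<lambda>t. g (t *\<^sub>R flip i (e *\<^sub>R 1))))"
proof -
  define E where "E e k = integral {0..1} (\<lambda>t. g (e *\<^sub>R 1 + t *\<^sub>R (flip k (e *\<^sub>R 1) - e *\<^sub>R 1)))" for e k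
  define H where "H e k = integral {0..1} (\<lambda>t. g (t *\<^sub>R (flip k (e *\<^sub>R 1))))" for e k
  let ?P = "{1, -1::real} \<times> {(i, k::3). i \<noteq> k}"
  let ?K = "\<lambda>(e, i, k). cube_tetra e i k"
  have fin: "finite ?P" by (simp add: finite_subset[OF subset_UNIV])
  have neg: "- flip i (e *\<^sub>R 1) = flip i ((- e) *\<^sub>R 1)" for i and e :: real
    by (auto simp: vec_eq_iff flip_nth)
  have ab: "g absolutely_integrable_on ?K p" if "p \<in> ?P" for p
    using that cube_tetra_bound(1) g by auto
  have le: "integral (?K p) g \<le> (case p of (e, i, k) \<Rightarrow> 1/3 * (E e k + H (- e) i))" if "p \<in> ?P" for p
  proof -
    obtain e i k where p: "p = (e, i, k)" "e \<in> {1, -1}" "i \<noteq> k"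
      using \<open>p \<in> ?P\<close> by blast
    show ?thesis
      using cube_tetra_bound(2)[OF p(2,3) g[OF p(2)]] unfolding p(1) prod.case neg E_def H_def .
  qed
  have dis: "?K p \<inter> ?K q = {}" if "p \<in> ?P" "q \<in> ?P" "p \<noteq> q" for p q
  proof -
    obtain e i k e' i' k' where p: "p = (e, i, k)" "e \<in> {1, -1}" "i \<noteq> k"
      and q: "q = (e', i', k')" "e' \<in> {1, -1}" "i' \<noteq> k'"
      using \<open>p \<in> ?P\<close> \<open>q \<in> ?P\<close> by blast
    show ?thesis
      using cube_tetra_disjoint[OF p(2) q(2) _ _ p(3) q(3)] \<open>p \<noteq> q\<close> unfolding p(1) q(1) by auto
  qed
  have sub: "(\<Union>p\<in>?P. ?K p) \<subseteq> std_cube"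
    by (intro UN_least) (use cube_tetra_subset in \<open>auto simp del: insert_iff\<close>)
  \<comment> \<open>Stated for general \<open>h\<close> so as to serve both \<open>g\<close> and its
    absolute value, which together give absolute integrability.\<close>
  have spl: "(h has_integral (\<Sum>p\<in>?P. integral (?K p) h)) std_cube"
    if "\<And>p. p \<in> ?P \<Longrightarrow> h integrable_on ?K p" for h :: "real^3 \<Rightarrow> real"
  proof -
    have "(h has_integral (\<Sum>p\<in>?P. integral (?K p) h)) (\<Union>p\<in>?P. ?K p)"
      by (rule has_integral_UN[OF fin]) (use that dis in \<open>auto simp: pairwise_def has_integral_integral[symmetric]\<close>)
    then show ?thesis
    proof (rule has_integral_spike_set_eq[THEN iffD1, rotated 2])
      show "negligible {x \<in> (\<Union>p\<in>?P. ?K p) - std_cube. h x \<noteq> 0}"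
        by (rule negligible_subset[OF negligible_empty]) (use sub in blast)
      show "negligible {x \<in> std_cube - (\<Union>p\<in>?P. ?K p). h x \<noteq> 0}"
        by (rule negligible_subset[OF negligible_std_cube_diff]) auto
    qed
  qed
  have "g integrable_on std_cube" "(\<lambda>x. norm (g x)) integrable_on std_cube"
    using spl[of g] spl[of "\<lambda>x. norm (g x)"] ab unfolding absolutely_integrable_on_def by blast+
  then show "g absolutely_integrable_on std_cube" by (simp add: absolutely_integrable_on_def)
  have "(g has_integral (\<Sum>p\<in>?P. integral (?K p) g)) std_cube"
    using spl[of g] ab unfolding absolutely_integrable_on_def by blast
  then have "integral std_cube g = (\<Sum>p\<in>?P. integral (?K p) g)" by (rule integral_unique)
  also have "\<dots> \<le> (\<Sum>(e, i, k)\<in>?P. 1/3 * (E e k + H (- e) i))"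
    using le by (rule sum_mono)
  also have "\<dots> = 2/3 * (\<Sum>(e, i)\<in>{1, -1} \<times> UNIV. E e i + H e i)"
  proof -
    have "{(i, k::3). i \<noteq> k} = {(1,2),(1,3),(2,1),(2,3),(3,1),(3,2)}"
      by (simp add: set_eq_iff forall_3)
    then show ?thesis
      by (simp add: sum.cartesian_product[symmetric] sum_3 algebra_simps)
  qed
  finally show "integral std_cube g \<le> 2/3 * (\<Sum>(e, i)\<in>{1, -1} \<times> UNIV.
       integral {0..1} (\<lambda>t. g (e *\<^sub>R 1 + t *\<^sub>R (flip i (e *\<^sub>R 1) - e *\<^sub>R 1)))
     + integral {0..1} (\<lambda>t. g (t *\<^sub>R flip i (e *\<^sub>R 1))))"
    by (simp add: E_def H_def)
qed

section \<open>Averages over segments\<close>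

text \<open>When all segments have the same length, it cancels and the average is the arithmetic
  mean of the parameter integrals. Injectivity makes every index count once.\<close>

lemma segs_avg_image:
  assumes "inj_on h A" "d > 0" and d: "\<And>a. a \<in> A \<Longrightarrow> dist (fst (h a)) (snd (h a)) = d"
  shows "segs_avg f (h ` A) =
    (\<Sum>a\<in>A. integral {0..1} (\<lambda>t. f (fst (h a) + t *\<^sub>R (snd (h a) - fst (h a))))) / card A"
proof -
  have "(\<Sum>(a, b)\<in>h ` A. seg_integral f a b) =
      d * (\<Sum>a\<in>A. integral {0..1} (\<lambda>t. f (fst (h a) + t *\<^sub>R (snd (h a) - fst (h a)))))"
    using d by (simp add: sum.reindex[OF assms(1)] case_prod_beta seg_integral_def sum_distrib_left)
  moreover have "(\<Sum>(a, b)\<in>h ` A. dist a b) = d * card A"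
    using d by (simp add: sum.reindex[OF assms(1)] case_prod_beta)
  ultimately show ?thesis using \<open>d > 0\<close> by (simp add: segs_avg_def)
qed

text \<open>The substitution \<open>x = 1 - 2 * t\<close> runs through a whole diagonal, with the
  centre at \<open>x = 0\<close>. The halves are kept apart because \<open>f\<close> is convex along
  each half but may fail to be convex across the centre.\<close>

lemma integral_through_centre:
  fixes F :: "real \<Rightarrow> real"
  assumes "F integrable_on {0..1}" "(\<lambda>x. F (- x)) integrable_on {0..1}"
  shows "integral {0..1} (\<lambda>t. F (1 - 2 * t)) = 1/2 * (integral {0..1} F + integral {0..1} (\<lambda>x. F (- x)))"
proof (rule integral_unique)
  have "(F has_integral integral {0..1} (\<lambda>x. F (- x))) {-1..0}"
    using assms(2) has_integral_reflect_real[where f = F and a = "-1" and b = 0]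
    by (simp add: has_integral_integral)
  then have "(F has_integral integral {0..1} (\<lambda>x. F (- x)) + integral {0..1} F) {-1..1}"
    using assms(1) by (intro has_integral_combine[of "-1" 0 1]) (auto simp: has_integral_integral)
  from has_integral_affinity[of F _ "-1" 1 "-2" 1, unfolded cbox_interval, OF this]
  have "((\<lambda>t. F (1 - 2 * t)) has_integral 1/2 * (integral {0..1} F + integral {0..1} (\<lambda>x. F (- x))))
      ((\<lambda>x. - (1/2) * x + 1/2) ` {-1..1})"
    by (simp add: algebra_simps)
  moreover have "(\<lambda>x. - (1/2) * x + 1/2) ` {-1..1} = {0..1::real}"
    using image_affinity_atLeastAtMost[of "-(1/2)" "1/2" "-1" "1::real"] by simp
  ultimately show "((\<lambda>t. F (1 - 2 * t)) has_integral 1/2 * (integral {0..1} F + integral {0..1} (\<lambda>x. F (- x)))) {0..1}"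
    by simp
qed

section \<open>Vertices as sign vectors, lengths of edges and diagonals\<close>

lemma signs_nth: "s \<in> signs \<Longrightarrow> s $ i = 1 \<or> s $ i = -1"
  by (simp add: signs_def)

lemma flip_signs: "s \<in> signs \<Longrightarrow> flip i s \<in> signs"
  by (auto simp: signs_def flip_nth)

lemma minus_signs: "s \<in> signs \<Longrightarrow> - s \<in> signs"
  by (auto simp: signs_def)

lemma norm_signs: "s \<in> signs \<Longrightarrow> norm s = sqrt 3"
proof -
  assume "s \<in> signs"
  then have "(s $ i)\<^sup>2 = 1" for i by (auto simp: signs_def power2_eq_1_iff)
  then show ?thesis by (simp add: norm_vec_def L2_set_def)
qed

lemma dist_minus_signs: "s \<in> signs \<Longrightarrow> dist s (- s) = 2 * sqrt 3"
proof -
  assume "s \<in> signs"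
  then have "norm (2 *\<^sub>R s) = 2 * sqrt 3" by (simp only: norm_scaleR norm_signs)
  then show ?thesis unfolding dist_norm scaleR_2 by simp
qed

lemma dist_flip: "s \<in> signs \<Longrightarrow> dist s (flip i s) = 2"
proof -
  assume s: "s \<in> signs"
  have "s - flip i s = (2 * s $ i) *\<^sub>R axis i 1"
    by (simp add: vec_eq_iff flip_nth axis_def)
  moreover have "\<bar>s $ i\<bar> = 1" using signs_nth[OF s, of i] by auto
  ultimately show ?thesis by (simp add: dist_norm abs_mult)
qed

text \<open>The vertices other than \<sigma> and its opposite are \<open>flip i \<sigma>\<close> and
  their negatives. Fixing the first sign picks one end of each diagonal:
  \<open>flip i \<sigma>\<close> itself, except for \<open>i = 1\<close>, where the flip has changed
  that sign.\<close>

lemma middle_diagonal_ends: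
  assumes "\<sigma> \<in> signs"
  shows "{s \<in> signs. s \<noteq> \<sigma> \<and> s \<noteq> - \<sigma> \<and> s $ 1 = \<sigma> $ 1} = (\<lambda>i. if i = 1 then - flip 1 \<sigma> else flip i \<sigma>) ` UNIV"
proof -
  have \<sigma>: "\<sigma> $ i \<noteq> 0" for i using signs_nth[OF assms, of i] by auto
  have signs: "s \<in> signs \<longleftrightarrow> (\<forall>i. s $ i = \<sigma> $ i \<or> s $ i = - \<sigma> $ i)" for s
  proof -
    have "(s $ i = 1 \<or> s $ i = -1) \<longleftrightarrow> (s $ i = \<sigma> $ i \<or> s $ i = - \<sigma> $ i)" for i
      using signs_nth[OF assms, of i] by auto
    then show ?thesis by (simp add: signs_def)
  qed
  have "{s \<in> signs. s \<noteq> \<sigma> \<and> s \<noteq> - \<sigma> \<and> s $ 1 = \<sigma> $ 1} = {- flip 1 \<sigma>, flip 2 \<sigma>, flip 3 \<sigma>}"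
  proof (rule set_eqI)
    fix s
    show "s \<in> {s \<in> signs. s \<noteq> \<sigma> \<and> s \<noteq> - \<sigma> \<and> s $ 1 = \<sigma> $ 1} \<longleftrightarrow> s \<in> {- flip 1 \<sigma>, flip 2 \<sigma>, flip 3 \<sigma>}"
      using \<sigma>[of 1] \<sigma>[of 2] \<sigma>[of 3]
      by (auto simp: signs vec_eq_iff forall_3 flip_nth)
  qed
  also have "\<dots> = (\<lambda>i. if i = 1 then - flip 1 \<sigma> else flip i \<sigma>) ` UNIV"
    unfolding UNIV_3 by auto
  finally show ?thesis .
qed

section \<open>Transport to a general cube and comparison of the averages\<close>

theorem theorem8p2:
  fixes c :: "real^3" and r :: real and T :: "real^3 \<Rightarrow> real^3"
    and f :: "real^3 \<Rightarrow> real" and \<sigma> :: "real^3"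
  assumes r: "r > 0"
    and T: "orthogonal_transformation T"
    and conv: "\<And>i e. e \<in> {1, -1} \<Longrightarrow> convex_on (pyramid c r T i e) f"
    and \<sigma>: "\<sigma> \<in> signs"
  shows "vol_avg f (cube c r T) \<le>
     1/2 * segs_avg f ((\<lambda>(s, i). (cube_map c r T s, cube_map c r T (flip i s))) ` ({\<sigma>, - \<sigma>} \<times> UNIV))
   + 1/2 * segs_avg f ((\<lambda>s. (cube_map c r T s, cube_map c r T (- s))) `
                        {s \<in> signs. s \<noteq> \<sigma> \<and> s \<noteq> - \<sigma> \<and> s $ 1 = \<sigma> $ 1})"
proof -
  let ?\<Phi> = "cube_map c r T"
  have linT: "linear T" and injT: "inj T"
    using T orthogonal_transformation_linear orthogonal_transformation_inj by blast+
  \<comment> \<open>\<open>\<tau>\<close> moves \<open>(1, 1, 1)\<close> to \<open>\<sigma>\<close>\<close>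
  define \<tau> :: "real^3 \<Rightarrow> real^3" where "\<tau> x = (\<chi> i. \<sigma> $ i * x $ i)" for x
  note \<sigma>' = signs_nth[OF \<sigma>]
  have \<sigma>2: "\<sigma> $ i * \<sigma> $ i = 1" for i using \<sigma>'[of i] by auto
  have \<tau>\<tau>: "\<tau> (\<tau> x) = x" for x by (simp add: \<tau>_def vec_eq_iff mult.assoc[symmetric] \<sigma>2)
  have lin\<tau>: "linear \<tau>" by (rule linearI) (simp_all add: \<tau>_def vec_eq_iff algebra_simps)
  have \<tau>flip: "\<tau> (flip i x) = flip i (\<tau> x)" for i x by (simp add: \<tau>_def vec_eq_iff flip_nth)
  have \<tau>1: "\<tau> (e *\<^sub>R 1) = e *\<^sub>R \<sigma>" for e by (simp add: \<tau>_def vec_eq_iff)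
  have \<tau>cube: "\<tau> ` std_cube = std_cube"
  proof -
    have "\<tau> x \<in> std_cube" if "x \<in> std_cube" for x
    proof -
      have "\<bar>\<tau> x $ i\<bar> = \<bar>x $ i\<bar>" for i using \<sigma>'[of i] by (auto simp: \<tau>_def)
      then show ?thesis using that by (simp add: std_cube_def)
    qed
    then show ?thesis using \<tau>\<tau> by (auto simp: image_iff) (metis \<tau>\<tau>)
  qed
  define L where "L x = r *\<^sub>R T (\<tau> x)" for x
  define g where "g x = f (c + L x)" for x
  have linL: "linear L"
    unfolding L_def by (intro linear_compose_scale_right linear_compose[OF lin\<tau> linT, unfolded o_def])
  have injL: "inj L"
  proof (rule injI)
    fix x y assume "L x = L y"
    then have "\<tau> x = \<tau> y" using r injT by (simp add: L_def inj_eq)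
    then show "x = y" using \<tau>\<tau> by metis
  qed
  have \<Phi>\<tau>: "?\<Phi> (\<tau> x) = c + L x" for x by (simp add: cube_map_def L_def)
  have cube: "cube c r T = (\<lambda>x. c + L x) ` std_cube"
    unfolding cube_def by (subst \<tau>cube[symmetric]) (simp add: image_image \<Phi>\<tau>)

  \<comment> \<open>Since \<tau> multiplies coordinate \<open>i\<close> by
    \<open>\<sigma> $ i\<close>, the pyramid for \<open>e\<close> is carried into the pyramid of the
    given cube with sign \<open>\<sigma> $ i * e\<close>.\<close>
  have g: "convex_on (convex hull (insert 0 {s \<in> signs. s $ i = e})) g" if e: "e \<in> {1, -1}" for i e
  proof -
    let ?S = "insert 0 {s \<in> signs. s $ i = e}"
    have "(\<lambda>x. c + L x) ` (convex hull ?S) = convex hull ((\<lambda>x. c + L x) ` ?S)"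
      by (simp only: image_image[of "(+) c" L, symmetric] convex_hull_linear_image[OF linL]
          convex_hull_translation)
    also have "\<dots> \<subseteq> pyramid c r T i (\<sigma> $ i * e)"
      unfolding pyramid_def
    proof (rule hull_mono, rule image_subsetI)
      fix x assume "x \<in> ?S"
      then consider "x = 0" | "x \<in> signs" "x $ i = e" by blast
      then show "c + L x \<in> insert c (?\<Phi> ` {s \<in> signs. s $ i = \<sigma> $ i * e})"
      proof cases
        case 1 then show ?thesis using linear_0[OF linL] by simp
      next
        case 2
        have "\<tau> x \<in> signs"
        proof -
          have "\<tau> x $ j = 1 \<or> \<tau> x $ j = -1" for j
            using \<sigma>'[of j] signs_nth[OF 2(1), of j] by (auto simp: \<tau>_def)
          then show ?thesis by (simp add: signs_def)
        qed
        moreover have "\<tau> x $ i = \<sigma> $ i * e" using 2 by (simp add: \<tau>_def)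
        ultimately show ?thesis unfolding \<Phi>\<tau>[symmetric] by blast
      qed
    qed
    finally have sub: "(\<lambda>x. c + L x) ` (convex hull ?S) \<subseteq> pyramid c r T i (\<sigma> $ i * e)" .
    have "convex_on (pyramid c r T i (\<sigma> $ i * e)) f"
      using e \<sigma>'[of i] by (intro conv) auto
    then show ?thesis
      unfolding g_def by (rule convex_on_affine_compose[OF _ convex_convex_hull linL sub])
  qed

  define E where "E e i = integral {0..1} (\<lambda>t. g (e *\<^sub>R 1 + t *\<^sub>R (flip i (e *\<^sub>R 1) - e *\<^sub>R 1)))" for e i
  define H where "H e i = integral {0..1} (\<lambda>t. g (t *\<^sub>R flip i (e *\<^sub>R 1)))" for e i
  have bound: "integral std_cube g \<le> 2/3 * (\<Sum>(e, i)\<in>{1, -1} \<times> UNIV. E e i + H e i)"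
    unfolding E_def H_def by (rule std_cube_bound(2)[OF g])

  \<comment> \<open>This constant Jacobian multiplies both the integral and the volume, so it
    cancels in the average and only its positivity matters.\<close>
  let ?d = "\<bar>det (matrix L)\<bar>"
  have d: "?d > 0" using det_nz_iff_inj[OF linL] injL by simp
  have der: "((\<lambda>x. c + L x) has_derivative L) (at x within std_cube)" for x
    using linear_imp_has_derivative[OF linL] by (auto intro!: derivative_eq_intros)
  have inj: "inj_on (\<lambda>x. c + L x) std_cube"
    using injL by (auto simp: inj_on_def)
  have std: "std_cube \<in> lmeasurable" by (simp add: std_cube_eq_cbox)
  have m8: "measure lebesgue std_cube = 8"
    by (simp add: std_cube_eq_cbox content_cbox_if_cart interval_eq_empty_cart)
  have "(\<lambda>x. ?d * g x) absolutely_integrable_on std_cube"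
    using std_cube_bound(1)[OF g] by simp
  then have "integral (cube c r T) f = ?d * integral std_cube g"
    using absolute_integral_change_of_variables_scalar(2)[OF fmeasurableD[OF std] der inj, of f]
    unfolding cube g_def by simp
  moreover have "measure lebesgue (cube c r T) = ?d * 8"
  proof -
    have "compact (cube c r T)"
      unfolding cube std_cube_eq_cbox
      by (intro compact_continuous_image compact_cbox continuous_intros linear_continuous_on
          linear_conv_bounded_linear[THEN iffD1, OF linL])
    then have "measure lebesgue (cube c r T) = integral (cube c r T) (\<lambda>x. 1)"
      by (intro lmeasure_integral lmeasurable_compact)
    also have "\<dots> = integral std_cube (\<lambda>x. ?d * 1)"
      unfolding cube
      by (rule absolute_integral_change_of_variables_scalar(2)[OF fmeasurableD[OF std] der inj])
        (simp add: absolutely_integrable_on_const std)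
    also have "\<dots> = ?d * 8" unfolding integral_mult_right lmeasure_integral[OF std, symmetric] m8 ..
    finally show ?thesis .
  qed
  ultimately have vol: "vol_avg f (cube c r T) = integral std_cube g / 8"
    using d by (simp add: vol_avg_def)

  have "dist (T a) (T b) = dist a b" for a b
    using T by (simp add: orthogonal_transformation_isometry)
  then have dist\<Phi>: "dist (?\<Phi> a) (?\<Phi> b) = r * dist a b" for a b
    using r by (simp add: cube_map_def dist_norm flip: scaleR_diff_right)
  have inj\<Phi>: "?\<Phi> a = ?\<Phi> b \<longleftrightarrow> a = b" for a b
    using r injT by (auto simp: cube_map_def inj_def)
  have seg: "f (?\<Phi> (\<tau> a) + t *\<^sub>R (?\<Phi> (\<tau> b) - ?\<Phi> (\<tau> a))) = g (a + t *\<^sub>R (b - a))" for a b t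
    by (simp add: \<Phi>\<tau> g_def linear_add[OF linL] linear_diff[OF linL] linear_scale[OF linL] algebra_simps)
  have ne: "\<sigma> \<noteq> - \<sigma>" using \<sigma>'[of 1] by (auto simp: vec_eq_iff intro!: exI[of _ 1])

  have "segs_avg f ((\<lambda>(s, i). (?\<Phi> s, ?\<Phi> (flip i s))) ` ({\<sigma>, - \<sigma>} \<times> UNIV))
    = (\<Sum>(s, i)\<in>{\<sigma>, - \<sigma>} \<times> UNIV. integral {0..1} (\<lambda>t. f (?\<Phi> s + t *\<^sub>R (?\<Phi> (flip i s) - ?\<Phi> s)))) / 6"
  proof (subst segs_avg_image[where d = "2 * r"])
    show "inj_on (\<lambda>(s, i). (?\<Phi> s, ?\<Phi> (flip i s))) ({\<sigma>, - \<sigma>} \<times> UNIV)"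
    proof (rule inj_onI)
      fix p q assume p: "p \<in> {\<sigma>, - \<sigma>} \<times> UNIV"
        and "(case p of (s, i) \<Rightarrow> (?\<Phi> s, ?\<Phi> (flip i s))) = (case q of (s, i) \<Rightarrow> (?\<Phi> s, ?\<Phi> (flip i s)))"
      then have eq: "fst p = fst q" "flip (snd p) (fst p) = flip (snd q) (fst p)"
        by (auto simp: case_prod_beta inj\<Phi>)
      have "fst p \<in> signs" using p \<sigma> minus_signs by auto
      with eq show "p = q" by (simp add: flip_eq_iff prod_eq_iff)
    qed
  qed (use r \<sigma> ne in \<open>auto simp: dist\<Phi> dist_flip minus_signs case_prod_beta\<close>)
  also have "\<dots> = (\<Sum>(e, i)\<in>{1, -1} \<times> UNIV. E e i) / 6"
  proof -
    have *: "integral {0..1} (\<lambda>t. f (?\<Phi> (e *\<^sub>R \<sigma>) + t *\<^sub>R (?\<Phi> (flip i (e *\<^sub>R \<sigma>)) - ?\<Phi> (e *\<^sub>R \<sigma>)))) = E e i" for e i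
      unfolding E_def \<tau>1[symmetric] \<tau>flip[symmetric] seg ..
    show ?thesis
      using *[of 1] *[of "-1"] ne by (simp add: sum.cartesian_product[symmetric])
  qed
  finally have edges: "segs_avg f ((\<lambda>(s, i). (?\<Phi> s, ?\<Phi> (flip i s))) ` ({\<sigma>, - \<sigma>} \<times> UNIV))
    = (\<Sum>(e, i)\<in>{1, -1} \<times> UNIV. E e i) / 6" .

  have half: "(\<lambda>t. g (t *\<^sub>R w)) integrable_on {0..1}" if w: "w \<in> signs" for w
  proof (rule convex_on_unit_interval_integrable(2))
    \<comment> \<open>The half-diagonal to \<open>w\<close> lies in the pyramid over any face
      containing \<open>w\<close>; the face fixing coordinate 1 is chosen.\<close>
    let ?C = "convex hull (insert 0 {s \<in> signs. s $ 1 = w $ 1})"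
    have in_C: "t *\<^sub>R w \<in> ?C" if "t \<in> {0..1}" for t
      using convexD[OF convex_convex_hull, of 0 "insert 0 {s \<in> signs. s $ 1 = w $ 1}" w "1 - t" t] that w
      by (simp add: hull_inc)
    have "convex_on ?C g" using w by (intro g) (auto simp: signs_def)
    then have "convex_on {0..1} (\<lambda>t. g (0 + t *\<^sub>R w))"
      by (rule convex_on_affine_compose)
        (use in_C in \<open>auto simp: linear_iff algebra_simps\<close>)
    then show "convex_on {0..1} (\<lambda>t. g (t *\<^sub>R w))" by simp
  qed
  \<comment> \<open>The value is symmetric in the two ends, so either end of the diagonal may serve
    as \<open>s\<close>; this covers the exceptional end for \<open>i = 1\<close>.\<close>
  have diag: "integral {0..1} (\<lambda>t. f (?\<Phi> s + t *\<^sub>R (?\<Phi> (- s) - ?\<Phi> s))) = 1/2 * (H 1 i + H (- 1) i)"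
    if s: "s = flip i \<sigma> \<or> s = - flip i \<sigma>" for s i
  proof -
    define w where "w = \<tau> s"
    have fl: "flip i 1 \<in> signs" by (auto simp: signs_def flip_nth)
    have \<tau>\<sigma>: "\<tau> (flip i \<sigma>) = flip i 1" using \<tau>flip[of i 1] \<tau>1[of 1] \<tau>\<tau> by (metis scaleR_one)
    have w: "w = flip i 1 \<or> w = - flip i 1"
      using s \<tau>\<sigma> linear_neg[OF lin\<tau>] by (auto simp: w_def)
    have "f (?\<Phi> s + t *\<^sub>R (?\<Phi> (- s) - ?\<Phi> s)) = g ((1 - 2 * t) *\<^sub>R w)" for t
    proof -
      have "w + t *\<^sub>R (- w - w) = (1 - 2 * t) *\<^sub>R w" by (simp add: vec_eq_iff algebra_simps)
      moreover have "\<tau> w = s" "\<tau> (- w) = - s"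
        using \<tau>\<tau> linear_neg[OF lin\<tau>, of w] by (simp_all add: w_def)
      ultimately show ?thesis using seg[of w t "- w"] by simp
    qed
    then have "integral {0..1} (\<lambda>t. f (?\<Phi> s + t *\<^sub>R (?\<Phi> (- s) - ?\<Phi> s)))
        = 1/2 * (integral {0..1} (\<lambda>t. g (t *\<^sub>R w)) + integral {0..1} (\<lambda>t. g (t *\<^sub>R - w)))"
      using integral_through_centre[of "\<lambda>t. g (t *\<^sub>R w)"] half[of w] half[of "- w"] w fl minus_signs[OF fl]
      by auto
    moreover have "flip i (- 1 *\<^sub>R 1) = - flip i 1" by (simp add: vec_eq_iff flip_nth)
    ultimately show ?thesis using w by (auto simp: H_def)
  qed
  let ?v = "\<lambda>i. if i = 1 then - flip 1 \<sigma> else flip i \<sigma>"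
  have "segs_avg f ((\<lambda>s. (?\<Phi> s, ?\<Phi> (- s))) ` ?v ` UNIV)
    = (\<Sum>i\<in>UNIV. integral {0..1} (\<lambda>t. f (?\<Phi> (?v i) + t *\<^sub>R (?\<Phi> (- ?v i) - ?\<Phi> (?v i))))) / 3"
    unfolding image_image
  proof (subst segs_avg_image[where d = "r * (2 * sqrt 3)"])
    show "inj (\<lambda>i. (?\<Phi> (?v i), ?\<Phi> (- ?v i)))"
    proof (rule injI)
      fix i j assume "(?\<Phi> (?v i), ?\<Phi> (- ?v i)) = (?\<Phi> (?v j), ?\<Phi> (- ?v j))"
      then have "?v i = ?v j" by (simp add: inj\<Phi>)
      then show "i = j"
        using \<sigma>'[of 1] \<sigma>'[of 2] \<sigma>'[of 3] exhaust_3[of i] exhaust_3[of j]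
        by (auto simp: vec_eq_iff forall_3 flip_nth)
    qed
    show "dist (fst (?\<Phi> (?v i), ?\<Phi> (- ?v i))) (snd (?\<Phi> (?v i), ?\<Phi> (- ?v i))) = r * (2 * sqrt 3)" for i
    proof -
      have "?v i \<in> signs" using \<sigma> flip_signs minus_signs by auto
      then show ?thesis unfolding fst_conv snd_conv dist\<Phi> by (simp only: dist_minus_signs)
    qed
  qed (use r in auto)
  also have "\<dots> = (\<Sum>i\<in>UNIV. 1/2 * (H 1 i + H (- 1) i)) / 3"
    by (intro arg_cong[of _ _ "\<lambda>x. x / 3"] sum.cong refl diag) auto
  finally have diags: "segs_avg f ((\<lambda>s. (?\<Phi> s, ?\<Phi> (- s))) `
        {s \<in> signs. s \<noteq> \<sigma> \<and> s \<noteq> - \<sigma> \<and> s $ 1 = \<sigma> $ 1}) = (\<Sum>i\<in>UNIV. 1/2 * (H 1 i + H (- 1) i)) / 3"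
    unfolding middle_diagonal_ends[OF \<sigma>] .
  \<comment> \<open>The right side is 1/12 of the sum of all \<open>E e i\<close> and
    \<open>H e i\<close>: 1/2 * 1/6 for edges, 1/2 * 1/3 * 1/2 for half-diagonals. On the left,
    \<open>bound\<close> divided by the volume 8 gives the same factor.\<close>
  show ?thesis
    unfolding vol edges diags using bound
    by (simp add: sum.cartesian_product[symmetric] sum_3 sum.distrib field_simps)
qed

end
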